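(* Let $h\ge1$ and let $H(h)$ be the half graph with color classes $\{u_1,\ldots,u_h\}$ and $\{v_1,\ldots,v_h\}$, where $u_i$ is adjacent to $v_j$ if and only if $j\le h-i+1$. Let $(a_1,\ldots,a_6)=(1,0,-1,-1,0,1)$ and define $x_i=a_s$ whenever $i\equiv s\pmod 6$, $1\le s\le 6$, for $i=1,\dots,h$. Let $\mathbf{y}$ be the vector on $V(H(h))$ given by $\mathbf{y}(u_i)=\mathbf{y}(v_i)=x_i$ for $i=1,\ldots,h$. Then $\mathbf{y}$ is an eigenvector of the adjacency matrix of $H(h)$ for the eigenvalue $1$ if $h\equiv1\pmod 6$, and for the eigenvalue $-1$ if $h\equiv 4\pmod 6$.
   Context: The half graph $H(h)$ is the chain graph with all cells of size one, i.e. the bipartite graph described in the claim; its eigenvalues and eigenvectors are those of its adjacency matrix. *)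

theory Defs
  imports
    "HOL-Number_Theory.Cong"
    "Graph_Theory.Pair_Digraph"
    "Jordan_Normal_Form.Char_Poly"
begin

datatype half_graph_vertex = U nat | V nat

(* A simple graph is a symmetric loop-free digraph: each edge contributes both of its
   orientations to the arc set. *)
definition half_graph :: "nat \<Rightarrow> half_graph_vertex pair_pre_digraph" where
  "half_graph h =
    \<lparr> pverts = U ` {1..h} \<union> V ` {1..h},
      parcs = {(U i, V j) | i j. i \<in> {1..h} \<and> j \<in> {1..h} \<and> j \<le> h - i + 1}
            \<union> {(V j, U i) | i j. i \<in> {1..h} \<and> j \<in> {1..h} \<and> j \<le> h - i + 1} \<rparr>"

lemma pair_graph_half_graph: "pair_graph (half_graph h)"
proof
  show "finite (parcs (half_graph h))"
    by (rule finite_subset[of _ "(U ` {1..h} \<union> V ` {1..h}) \<times> (U ` {1..h} \<union> V ` {1..h})"])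
      (auto simp: half_graph_def)
  show "symmetric (with_proj (half_graph h))"
    by (auto simp: symmetric_def half_graph_def sym_def arcs_ends_def arc_to_ends_def)
qed (auto simp: half_graph_def)

(* Adjacency matrix and coordinate vector relative to an enumeration vs of the vertices:
   the vertex vs ! k has index k. *)
definition adjacency_matrix :: "'v pair_pre_digraph \<Rightarrow> 'v list \<Rightarrow> real mat" where
  "adjacency_matrix G vs =
    mat (length vs) (length vs) (\<lambda>(k, l). if (vs ! k, vs ! l) \<in> parcs G then 1 else 0)"

definition vertex_vec :: "('v \<Rightarrow> real) \<Rightarrow> 'v list \<Rightarrow> real vec" where
  "vertex_vec y vs = vec (length vs) (\<lambda>k. y (vs ! k))"

(* Indexed from 1; only a_seq 1, ..., a_seq 6 are meaningful. *)
definition a_seq :: "nat \<Rightarrow> real" where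
  "a_seq s = [1, 0, -1, -1, 0, 1] ! (s - 1)"

end

theory Submission
  imports Defs
begin

text \<open>
  The neighbours of \<open>u\<^sub>i\<close> are \<open>v\<^sub>1, \<dots>, v\<^bsub>h-i+1\<^esub>\<close> and vice versa, so the eigenvalue equation says that the
  partial sum \<open>x\<^sub>1 + \<dots> + x\<^bsub>h+1-i\<^esub>\<close> equals \<open>\<lambda> x\<^sub>i\<close>. As \<open>a\<^sub>1 + \<dots> + a\<^sub>6 = 0\<close>, the partial sums are
  again 6-periodic, with values \<open>1, 1, 0, -1, -1, 0\<close>: reading them backwards from \<open>h\<close> gives
  \<open>x\<close> if \<open>h \<equiv> 1\<close> and \<open>-x\<close> if \<open>h \<equiv> 4\<close> modulo 6.
\<close>

text \<open>Since \<open>vs\<close> enumerates the vertices bijectively, row \<open>k\<close> of the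
  matrix-vector product reindexes to the sum of \<open>y\<close> over the neighbours of
  \<open>vs ! k\<close>. The vertex \<open>v\<^sub>0\<close> keeps the vector nonzero.\<close>

lemma eigenvector_adjacency_matrixI:
  assumes "distinct vs" and "set vs = pverts G"
    and "v\<^sub>0 \<in> pverts G" and "y v\<^sub>0 \<noteq> 0"
    and eq: "\<And>v. v \<in> pverts G \<Longrightarrow> (\<Sum>w | w \<in> pverts G \<and> (v, w) \<in> parcs G. y w) = c * y v"
  shows "eigenvector (adjacency_matrix G vs) (vertex_vec y vs) c"
proof -
  let ?A = "adjacency_matrix G vs" and ?y = "vertex_vec y vs"
  obtain k\<^sub>0 where k\<^sub>0: "k\<^sub>0 < length vs" "vs ! k\<^sub>0 = v\<^sub>0"
    using assms(2,3) by (metis in_set_conv_nth)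
  then have "?y $ k\<^sub>0 \<noteq> 0\<^sub>v (length vs) $ k\<^sub>0"
    using assms(4) by (simp add: vertex_vec_def)
  then have nz: "?y \<noteq> 0\<^sub>v (length vs)" by metis
  have bij: "bij_betw ((!) vs) {0..<length vs} (pverts G)"
    using bij_betw_nth[OF assms(1) _ assms(2)[symmetric]] by (simp add: atLeast0LessThan)
  have "?A *\<^sub>v ?y = c \<cdot>\<^sub>v ?y"
  proof (rule eq_vecI)
    fix k assume "k < dim_vec (c \<cdot>\<^sub>v ?y)"
    then have k: "k < length vs" by (simp add: vertex_vec_def)
    have "(?A *\<^sub>v ?y) $ k =
        (\<Sum>l = 0..<length vs. (if (vs ! k, vs ! l) \<in> parcs G then y (vs ! l) else 0))"
      using k by (auto simp: adjacency_matrix_def vertex_vec_def scalar_prod_def intro!: sum.cong)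
    also have "\<dots> = (\<Sum>w\<in>pverts G. if (vs ! k, w) \<in> parcs G then y w else 0)"
      by (rule sum.reindex_bij_betw[OF bij])
    also have "\<dots> = (\<Sum>w | w \<in> pverts G \<and> (vs ! k, w) \<in> parcs G. y w)"
      by (rule sum.inter_filter[symmetric]) (simp flip: assms(2))
    also have "\<dots> = c * y (vs ! k)"
      using k assms(2) nth_mem by (blast intro: eq)
    finally show "(?A *\<^sub>v ?y) $ k = (c \<cdot>\<^sub>v ?y) $ k"
      using k by (simp add: vertex_vec_def)
  qed (simp add: adjacency_matrix_def vertex_vec_def)
  with nz show ?thesis
    by (simp add: eigenvector_def adjacency_matrix_def vertex_vec_def)
qed

text \<open>For 1 \<le> i \<le> h the truncated \<open>h - i + 1\<close> equals
  \<open>h + 1 - i\<close> and is at most \<open>h\<close>, so it absorbs the bound on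
  \<open>j\<close>.\<close>

lemma half_graph_neighbours_U:
  assumes "i \<in> {1..h}"
  shows "{w \<in> pverts (half_graph h). (U i, w) \<in> parcs (half_graph h)} = V ` {1..h + 1 - i}"
  using assms by (auto simp: half_graph_def)

lemma half_graph_neighbours_V:
  assumes "i \<in> {1..h}"
  shows "{w \<in> pverts (half_graph h). (V i, w) \<in> parcs (half_graph h)} = U ` {1..h + 1 - i}"
  using assms by (auto simp: half_graph_def)

text \<open>The list is that of \<open>a_seq\<close> rotated by one place: residue 0 stands for s =
  6, so \<open>a_seq 6\<close> comes first.\<close>

definition periodic_seq :: "nat \<Rightarrow> real" where
  "periodic_seq i = [1, 1, 0, -1, -1, 0] ! (i mod 6)"

lemma periodic_seq_eq_a_seq:
  assumes "s \<in> {1..6}" and "[i = s] (mod 6)"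
  shows "periodic_seq i = a_seq s"
proof -
  have "s \<in> {1, 2, 3, 4, 5, 6}" using assms(1) by auto
  with assms(2) show ?thesis
    by (auto simp: periodic_seq_def a_seq_def cong_def)
qed

lemma mod_6_in: "n mod 6 \<in> {0, 1, 2, 3, 4, 5}" for n :: nat
proof -
  have "n mod 6 < 6" by simp
  then show ?thesis by auto
qed

text \<open>The induction step is a check over the six residues of \<open>n\<close>; it wraps around
  because a full period sums to 0.\<close>

lemma sum_periodic_seq: "(\<Sum>j = 1..n. periodic_seq j) = [0, 1, 1, 0, -1, -1] ! (n mod 6)"
proof (induction n)
  case 0
  show ?case by simp
next
  case (Suc n)
  have "(\<Sum>j = 1..Suc n. periodic_seq j) = (\<Sum>j = 1..n. periodic_seq j) + periodic_seq (Suc n)"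
    by simp
  then show ?case
    unfolding Suc.IH using mod_6_in[of n]
    by (elim insertE emptyE) (simp_all add: periodic_seq_def mod_Suc)
qed

text \<open>Both sides depend only on residues modulo 6, which leaves finitely many pairs to check.
  The residue 2 is that of h + 1 when h is 1 modulo 6.\<close>

lemma sum_periodic_seq_2:
  assumes "(m + i) mod 6 = 2"
  shows "(\<Sum>j = 1..m. periodic_seq j) = periodic_seq i"
proof -
  have "[0, 1, 1, 0, -1, -1] ! a = ([1, 1, 0, -1, -1, 0] ! b :: real)"
    if "a \<in> {0, 1, 2, 3, 4, 5}" "b \<in> {0, 1, 2, 3, 4, 5}" "(a + b) mod 6 = 2" for a b :: nat
    using that by auto
  then show ?thesis
    unfolding sum_periodic_seq unfolding periodic_seq_def
    using mod_6_in assms by (simp only: mod_add_eq)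
qed

text \<open>The sign flips relative to residue 2 because a shift by 3 negates the sequence.\<close>

lemma sum_periodic_seq_5:
  assumes "(m + i) mod 6 = 5"
  shows "(\<Sum>j = 1..m. periodic_seq j) = - periodic_seq i"
proof -
  have "[0, 1, 1, 0, -1, -1] ! a = - ([1, 1, 0, -1, -1, 0] ! b :: real)"
    if "a \<in> {0, 1, 2, 3, 4, 5}" "b \<in> {0, 1, 2, 3, 4, 5}" "(a + b) mod 6 = 5" for a b :: nat
    using that by auto
  then show ?thesis
    unfolding sum_periodic_seq unfolding periodic_seq_def
    using mod_6_in assms by (simp only: mod_add_eq)
qed

theorem theorem3p7:
  fixes h :: nat
    and x :: "nat \<Rightarrow> real"
    and y :: "half_graph_vertex \<Rightarrow> real"
    and vs :: "half_graph_vertex list"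
  assumes "h \<ge> 1"
    and "\<And>i s. \<lbrakk> i \<in> {1..h}; s \<in> {1..6}; [i = s] (mod 6) \<rbrakk> \<Longrightarrow> x i = a_seq s"
    and "\<And>i. i \<in> {1..h} \<Longrightarrow> y (U i) = x i"
    and "\<And>i. i \<in> {1..h} \<Longrightarrow> y (V i) = x i"
    and "distinct vs"
    and "set vs = pverts (half_graph h)"
  shows "([h = 1] (mod 6) \<longrightarrow>
            eigenvector (adjacency_matrix (half_graph h) vs) (vertex_vec y vs) 1)
       \<and> ([h = 4] (mod 6) \<longrightarrow>
            eigenvector (adjacency_matrix (half_graph h) vs) (vertex_vec y vs) (-1))"
proof -
  have x: "x i = periodic_seq i" if "i \<in> {1..h}" for i
  proof -
    \<comment> \<open>The representative of \<open>i\<close> has to lie in 1..6, so residue 0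
      becomes 6.\<close>
    define s where "s = (if i mod 6 = 0 then 6 else i mod 6)"
    have "s \<in> {1..6}" and "[i = s] (mod 6)"
      by (auto simp: s_def cong_def intro: less_imp_le)
    then show ?thesis using assms(2)[OF that] periodic_seq_eq_a_seq by metis
  qed
  have ev: "eigenvector (adjacency_matrix (half_graph h) vs) (vertex_vec y vs) c"
    \<comment> \<open>Here \<open>m\<close> is the degree h + 1 - i of \<open>U i\<close> and of
      \<open>V i\<close>; only this identity depends on the residue of \<open>h\<close>.\<close>
    if c: "\<And>m i. m + i = h + 1 \<Longrightarrow> (\<Sum>j = 1..m. periodic_seq j) = c * periodic_seq i" for c
  proof (rule eigenvector_adjacency_matrixI[OF assms(5,6)])
    show "U 1 \<in> pverts (half_graph h)"
      using assms(1) by (auto simp: half_graph_def)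
    show "y (U 1) \<noteq> 0"
      using assms(1,3) x by (simp add: periodic_seq_def)
    fix v assume "v \<in> pverts (half_graph h)"
    then consider i where "i \<in> {1..h}" "v = U i" | i where "i \<in> {1..h}" "v = V i"
      by (auto simp: half_graph_def)
    then show "(\<Sum>w | w \<in> pverts (half_graph h) \<and> (v, w) \<in> parcs (half_graph h). y w) = c * y v"
    proof cases
      case (1 i)
      have "sum y (V ` {1..h + 1 - i}) = (\<Sum>j = 1..h + 1 - i. periodic_seq j)"
        using 1(1) assms(4) x by (subst sum.reindex) (auto simp: inj_on_def intro!: sum.cong)
      with 1 show ?thesis
        using c[of "h + 1 - i" i] assms(3) x by (simp add: half_graph_neighbours_U del: One_nat_def)
    next
      case (2 i)
      have "sum y (U ` {1..h + 1 - i}) = (\<Sum>j = 1..h + 1 - i. periodic_seq j)"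
        using 2(1) assms(3) x by (subst sum.reindex) (auto simp: inj_on_def intro!: sum.cong)
      with 2 show ?thesis
        using c[of "h + 1 - i" i] assms(4) x by (simp add: half_graph_neighbours_V del: One_nat_def)
    qed
  qed
  show ?thesis
  proof (intro conjI impI)
    assume "[h = 1] (mod 6)"
    then have "(h + 1) mod 6 = 2" by (simp add: cong_def mod_Suc)
    then show "eigenvector (adjacency_matrix (half_graph h) vs) (vertex_vec y vs) 1"
      by (intro ev) (simp add: sum_periodic_seq_2 del: One_nat_def)
  next
    assume "[h = 4] (mod 6)"
    then have "(h + 1) mod 6 = 5" by (simp add: cong_def mod_Suc)
    then show "eigenvector (adjacency_matrix (half_graph h) vs) (vertex_vec y vs) (-1)"
      by (intro ev) (simp add: sum_periodic_seq_5 del: One_nat_def)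
  qed
qed

end
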